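(* Let $X$ be a Banach space and let $\{\varphi_t : X\to X \mid t\ge 0\}$ be a semigroup of continuous linear operators such that for each $v\in X$ the function $t\mapsto \varphi_t(v)$ is continuous for $t>0$. Let $X_0=\{x\in X\mid \varphi_t(x)\to 0 \text{ as } t\to\infty\}$, and suppose that $X_0$ has at most countable codimension in $X$. Then $X_0$ is a closed subspace of $X$ and $\operatorname{codim} X_0<\infty$. If, moreover, $\varphi_t$ is a $C_0$-semigroup (i.e., for each $v\in X$ the function $t\mapsto\varphi_t(v)$ is also continuous at $t=0$), then the restriction $\varphi_t|_{X_0}:X_0\to X_0$ is a bounded semigroup.
   Context: A semigroup means $\varphi_t\circ\varphi_q=\varphi_{t+q}$ for all $t,q\ge 0$. Codimension is algebraic: $\operatorname{codim}X_0$ is the (Hamel) dimension of $X/X_0$; at most countable codimension means that this dimension is finite or countably infinite. A semigroup is bounded if there is a constant $C<\infty$ with $\|\varphi_t\|\le C$ for all $t\ge 0$. The subspace $X_0$ is $\varphi_t$-invariant: $\varphi_t(X_0)\subset X_0$. *)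

theory Defs
  imports "HOL-Analysis.Analysis"
begin

definition operator_semigroup :: "(real \<Rightarrow> 'a::real_normed_vector \<Rightarrow> 'a) \<Rightarrow> bool" where
  "operator_semigroup \<phi> \<longleftrightarrow>
     (\<forall>t\<ge>0. bounded_linear (\<phi> t)) \<and>
     (\<forall>t\<ge>0. \<forall>q\<ge>0. \<phi> t \<circ> \<phi> q = \<phi> (t + q))"

definition stable_subspace :: "(real \<Rightarrow> 'a::real_normed_vector \<Rightarrow> 'a) \<Rightarrow> 'a set" where
  "stable_subspace \<phi> = {x. ((\<lambda>t. \<phi> t x) \<longlongrightarrow> 0) at_top}"

text \<open>
  The quotient of the whole space by a linear subspace \<open>S\<close>: its elements are the cosets of \<open>S\<close>,
  and its zero vector is \<open>S\<close> itself.
\<close>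

definition coset :: "'a::real_vector set \<Rightarrow> 'a \<Rightarrow> 'a set" where
  "coset S x = (\<lambda>s. x + s) ` S"

definition quotient_space :: "'a::real_vector set \<Rightarrow> 'a set set" where
  "quotient_space S = range (coset S)"

text \<open>
  Linear combination of a finite set \<open>F\<close> of cosets in the quotient space, computed on
  representatives; the choice of representatives is immaterial, see \<open>quotient_lincomb_eq\<close>.
\<close>

definition quotient_lincomb :: "'a::real_vector set \<Rightarrow> 'a set set \<Rightarrow> ('a set \<Rightarrow> real) \<Rightarrow> 'a set" where
  "quotient_lincomb S F c = coset S (\<Sum>A\<in>F. c A *\<^sub>R (SOME x. x \<in> A))"

definition quotient_basis :: "'a::real_vector set \<Rightarrow> 'a set set \<Rightarrow> bool" where
  "quotient_basis S \<B> \<longleftrightarrow>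
     \<B> \<subseteq> quotient_space S \<and>
     (\<forall>F c. finite F \<and> F \<subseteq> \<B> \<and> quotient_lincomb S F c = S \<longrightarrow> (\<forall>A\<in>F. c A = 0)) \<and>
     (\<forall>Q\<in>quotient_space S. \<exists>F c. finite F \<and> F \<subseteq> \<B> \<and> Q = quotient_lincomb S F c)"

text \<open>All Hamel bases of the quotient are equinumerous, so it does not matter which one is used.\<close>

definition countable_codim :: "'a::real_vector set \<Rightarrow> bool" where
  "countable_codim S \<longleftrightarrow> (\<exists>\<B>. quotient_basis S \<B> \<and> countable \<B>)"

definition finite_codim :: "'a::real_vector set \<Rightarrow> bool" where
  "finite_codim S \<longleftrightarrow> (\<exists>\<B>. quotient_basis S \<B> \<and> finite \<B>)"

text \<open>
  Operator norm of the restriction of \<open>T\<close> to a subspace \<open>S\<close>. It is the formula of \<open>onorm\<close> with the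
  supremum over \<open>S\<close>, taken in the extended reals so that an unbounded restriction has norm \<open>\<infinity>\<close>.
\<close>

definition onorm_on :: "'a::real_normed_vector set \<Rightarrow> ('a \<Rightarrow> 'a) \<Rightarrow> ereal" where
  "onorm_on S T = (SUP x\<in>S. ereal (norm (T x) / norm x))"

definition bounded_semigroup_on ::
    "'a::real_normed_vector set \<Rightarrow> (real \<Rightarrow> 'a \<Rightarrow> 'a) \<Rightarrow> bool" where
  "bounded_semigroup_on S \<phi> \<longleftrightarrow>
     (\<forall>t\<ge>0. \<phi> t ` S \<subseteq> S) \<and>
     (\<forall>t\<ge>0. \<forall>q\<ge>0. \<forall>x\<in>S. \<phi> t (\<phi> q x) = \<phi> (t + q) x) \<and>
     (\<exists>C::real. \<forall>t\<ge>0. onorm_on S (\<phi> t) \<le> ereal C)"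

lemma coset_eq_iff:
  assumes "subspace S"
  shows "coset S x = coset S y \<longleftrightarrow> x - y \<in> S"
proof
  assume "coset S x = coset S y"
  moreover have "x \<in> coset S x"
    unfolding coset_def using subspace_0[OF assms] by (intro image_eqI[of _ _ 0]) auto
  ultimately show "x - y \<in> S" by (auto simp: coset_def)
next
  have *: "coset S u \<subseteq> coset S v" if "u - v \<in> S" for u v
  proof
    fix z assume "z \<in> coset S u"
    then obtain s where s: "s \<in> S" "z = u + s" by (auto simp: coset_def)
    have "z = v + ((u - v) + s)" using s by simp
    then show "z \<in> coset S v"
      using subspace_add[OF assms that s(1)] unfolding coset_def by blast
  qed
  assume "x - y \<in> S"
  moreover from this have "y - x \<in> S" using subspace_neg[OF assms] by fastforce
  ultimately show "coset S x = coset S y" using * by blast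
qed

lemma quotient_lincomb_eq:
  assumes S: "subspace S" and F: "F \<subseteq> quotient_space S" and r: "\<And>A. A \<in> F \<Longrightarrow> r A \<in> A"
  shows "quotient_lincomb S F c = coset S (\<Sum>A\<in>F. c A *\<^sub>R r A)"
proof -
  have "(SOME x. x \<in> A) - r A \<in> S" if "A \<in> F" for A
  proof -
    obtain a where a: "A = coset S a" using F \<open>A \<in> F\<close> unfolding quotient_space_def by blast
    have "(SOME x. x \<in> A) \<in> A" using r[OF \<open>A \<in> F\<close>] by (rule someI)
    then obtain s where "s \<in> S" "(SOME x. x \<in> A) = a + s" using a by (auto simp: coset_def)
    moreover obtain s' where "s' \<in> S" "r A = a + s'" using r[OF \<open>A \<in> F\<close>] a by (auto simp: coset_def)
    ultimately show ?thesis using subspace_diff[OF S] by simp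
  qed
  then have "(\<Sum>A\<in>F. c A *\<^sub>R ((SOME x. x \<in> A) - r A)) \<in> S"
    by (intro subspace_sum[OF S] subspace_scale[OF S])
  then show ?thesis
    unfolding quotient_lincomb_def coset_eq_iff[OF S]
    by (simp add: scaleR_diff_right sum_subtractf)
qed

end

theory Submission
  imports Defs
begin

text \<open>
  The proof rests on the Baire category theorem, used twice through one lemma
  (\<open>countable_exhaustion_absorbs_ball\<close>): if the multiples of a closed convex symmetric set \<open>C\<close>,
  together with the span of a countable set \<open>D\<close>, exhaust a Banach space, then a whole ball around
  the origin already lies in one multiple of \<open>C\<close> plus the span of finitely many vectors of \<open>D\<close>.

  Let \<open>X\<^sub>b\<close> be the space of all \<open>x\<close> whose orbit is bounded for \<open>t \<ge> 1\<close>. Continuity of orbits on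
  compact intervals gives \<open>X\<^sub>0 \<subseteq> X\<^sub>b\<close>, so \<open>X\<^sub>b\<close> also has at most countable codimension. Unlike
  \<open>X\<^sub>0\<close>, it is a union of multiples of a closed set, namely \<open>C = {x. \<forall>t\<ge>1. \<parallel>\<phi>\<^sub>t x\<parallel> \<le> 1}\<close>, so the
  Baire argument applies to it. Taking \<open>D\<close> independent modulo \<open>X\<^sub>b\<close> removes the contribution of
  \<open>D\<close> to vectors of \<open>X\<^sub>b\<close>, and the outcome is the uniform boundedness principle on the possibly
  proper subspace \<open>X\<^sub>b\<close>: there is \<open>M\<close> with \<open>\<parallel>\<phi>\<^sub>t x\<parallel> \<le> M \<parallel>x\<parallel>\<close> for \<open>t \<ge> 1\<close> and \<open>x \<in> X\<^sub>b\<close>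
  (\<open>uniform_bound_on_bounded_orbits\<close>).

  With this bound on \<open>X\<^sub>0\<close>, a limit of vectors of \<open>X\<^sub>0\<close> is again in \<open>X\<^sub>0\<close>. Now \<open>X\<^sub>0\<close> is itself an
  admissible \<open>C\<close>, and the Baire lemma says that \<open>X\<^sub>0\<close> and finitely many vectors span \<open>X\<close>. If the
  orbits are continuous also at \<open>t = 0\<close>, then the same uniform bound holds with \<open>t \<ge> 0\<close> in place of
  \<open>t \<ge> 1\<close>, which is boundedness of the restricted semigroup.
\<close>

section \<open>Countable exhaustions of a Banach space\<close>

definition box_combinations :: "real \<Rightarrow> 'a::real_vector set \<Rightarrow> 'a set" where
  "box_combinations k F = {\<Sum>v\<in>F. a v *\<^sub>R v | a. \<forall>v\<in>F. \<bar>a v\<bar> \<le> k}"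

lemma box_combinations_subset_span: "box_combinations k F \<subseteq> span F"
  unfolding box_combinations_def by (auto intro: span_sum span_scale span_base)

lemma compact_box_combinations:
  fixes F :: "'a::real_normed_vector set"
  assumes "finite F"
  shows "compact (box_combinations k F)"
  using assms
proof (induction F)
  case empty
  then show ?case by (simp add: box_combinations_def)
next
  case (insert w F)
  have "box_combinations k (insert w F)
      = {x + y | x y. x \<in> (\<lambda>c. c *\<^sub>R w) ` {-k..k} \<and> y \<in> box_combinations k F}" (is "?L = ?R")
  proof (intro equalityI subsetI)
    fix z assume "z \<in> ?L"
    then obtain a where a: "\<forall>v\<in>insert w F. \<bar>a v\<bar> \<le> k" "z = (\<Sum>v\<in>insert w F. a v *\<^sub>R v)"
      unfolding box_combinations_def by blast
    have "z = a w *\<^sub>R w + (\<Sum>v\<in>F. a v *\<^sub>R v)"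
      using a insert by simp
    moreover have "a w \<in> {-k..k}" using a by (simp add: abs_le_iff)
    ultimately show "z \<in> ?R"
      using a(1) unfolding box_combinations_def by blast
  next
    fix z assume "z \<in> ?R"
    then obtain c a where c: "c \<in> {-k..k}" and a: "\<forall>v\<in>F. \<bar>a v\<bar> \<le> k"
      and z: "z = c *\<^sub>R w + (\<Sum>v\<in>F. a v *\<^sub>R v)"
      unfolding box_combinations_def by blast
    have "(\<Sum>v\<in>F. a v *\<^sub>R v) = (\<Sum>v\<in>F. (a(w := c)) v *\<^sub>R v)"
      using insert by (intro sum.cong) auto
    then have "z = (\<Sum>v\<in>insert w F. (a(w := c)) v *\<^sub>R v)"
      using z insert by simp
    moreover have "\<forall>v\<in>insert w F. \<bar>(a(w := c)) v\<bar> \<le> k"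
      using a c by (auto simp: abs_le_iff)
    ultimately show "z \<in> ?L"
      unfolding box_combinations_def by blast
  qed
  moreover have "compact ((\<lambda>c. c *\<^sub>R w) ` {-k..k})"
    by (intro compact_continuous_image continuous_intros) auto
  ultimately show ?case
    using compact_sums[OF _ insert.IH] by presburger
qed

lemma convex_box_combinations: "convex (box_combinations k F)"
proof (rule convexI)
  fix x y u v :: real and p q
  assume "p \<in> box_combinations k F" "q \<in> box_combinations k F" and uv: "0 \<le> u" "0 \<le> v" "u + v = 1"
  then obtain a b where a: "\<forall>w\<in>F. \<bar>a w\<bar> \<le> k" "p = (\<Sum>w\<in>F. a w *\<^sub>R w)"
    and b: "\<forall>w\<in>F. \<bar>b w\<bar> \<le> k" "q = (\<Sum>w\<in>F. b w *\<^sub>R w)"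
    unfolding box_combinations_def by blast
  have "\<bar>u * a w + v * b w\<bar> \<le> k" if "w \<in> F" for w
  proof -
    have "\<bar>u * a w + v * b w\<bar> \<le> u * \<bar>a w\<bar> + v * \<bar>b w\<bar>"
      using uv by (metis abs_mult abs_of_nonneg abs_triangle_ineq)
    also have "\<dots> \<le> k"
      using that a(1) b(1) uv by (intro convex_bound_le) auto
    finally show ?thesis .
  qed
  moreover have "u *\<^sub>R p + v *\<^sub>R q = (\<Sum>w\<in>F. (u * a w + v * b w) *\<^sub>R w)"
    unfolding a b by (simp add: scaleR_sum_right sum.distrib scaleR_add_left)
  ultimately show "u *\<^sub>R p + v *\<^sub>R q \<in> box_combinations k F"
    unfolding box_combinations_def by (intro CollectI exI[of _ "\<lambda>w. u * a w + v * b w"]) simp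
qed

lemma uminus_box_combinations:
  assumes "p \<in> box_combinations k F"
  shows "- p \<in> box_combinations k F"
proof -
  obtain a where a: "\<forall>w\<in>F. \<bar>a w\<bar> \<le> k" "p = (\<Sum>w\<in>F. a w *\<^sub>R w)"
    using assms unfolding box_combinations_def by blast
  then have "- p = (\<Sum>w\<in>F. (- a w) *\<^sub>R w)" by (simp add: sum_negf)
  moreover have "\<forall>w\<in>F. \<bar>- a w\<bar> \<le> k" using a(1) by simp
  ultimately show ?thesis unfolding box_combinations_def by (intro CollectI exI[of _ "\<lambda>w. - a w"]) simp
qed

lemma span_in_box_combinations:
  assumes "d \<in> span D"
  obtains F and k :: nat where "finite F" "F \<subseteq> D" "d \<in> box_combinations (real k) F"
proof -
  obtain F a where F: "finite F" "F \<subseteq> D" and d: "d = (\<Sum>v\<in>F. a v *\<^sub>R v)"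
    using assms unfolding span_explicit by blast
  obtain k :: nat where k: "(\<Sum>v\<in>F. \<bar>a v\<bar>) \<le> real k"
    using real_arch_simple by blast
  have "\<bar>a v\<bar> \<le> real k" if "v \<in> F" for v
    using member_le_sum[of v F "\<lambda>v. \<bar>a v\<bar>"] that F(1) k by auto
  then have "d \<in> box_combinations (real k) F"
    unfolding d box_combinations_def by blast
  then show thesis using that F by blast
qed

lemma convex_symmetric_interior_imp_ball:
  fixes K :: "'a::real_normed_vector set"
  assumes "convex K" "\<And>x. x \<in> K \<Longrightarrow> - x \<in> K" "interior K \<noteq> {}"
  obtains r where "r > 0" "ball 0 r \<subseteq> K"
proof -
  obtain z e where e: "e > 0" "ball z e \<subseteq> K"
    using assms(3) by (metis all_not_in_conv mem_interior)
  \<comment> \<open>\<open>x\<close> is the midpoint of \<open>z + x\<close> and of the reflection \<open>x - z\<close> of \<open>z - x\<close>.\<close>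
  have "x \<in> K" if "x \<in> ball 0 e" for x
  proof -
    have "z + x \<in> K" "z - x \<in> K"
      using that e(2) by (auto simp: dist_norm subset_iff)
    then have "(1/2) *\<^sub>R (z + x) + (1/2) *\<^sub>R (- (z - x)) \<in> K"
      by (intro convexD[OF assms(1)] assms(2)) auto
    moreover have "(1/2) *\<^sub>R (z + x) + (1/2) *\<^sub>R (- (z - x)) = x"
      by (simp add: algebra_simps flip: scaleR_add_left)
    ultimately show "x \<in> K" by simp
  qed
  then show thesis using that e(1) by blast
qed

text \<open>
  The span of a finite set is replaced by the combinations with coefficients in a box: these are
  compact, so adding them to a multiple of \<open>C\<close> keeps it closed, and countably many boxes cover
  \<open>span D\<close>. The Baire category theorem then finds one sum with interior points, and symmetry and
  convexity move the interior to the origin.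
\<close>

lemma countable_exhaustion_absorbs_ball:
  fixes C :: "'a::banach set"
  assumes C: "closed C" "convex C" "\<And>x. x \<in> C \<Longrightarrow> - x \<in> C"
    and D: "countable D"
    and exhaust: "\<And>x. \<exists>m::nat. \<exists>c\<in>C. \<exists>d\<in>span D. x = real m *\<^sub>R c + d"
  obtains r and m :: nat and F where "r > 0" "finite F" "F \<subseteq> D"
    "\<And>x. norm x < r \<Longrightarrow> \<exists>c\<in>C. \<exists>d\<in>span F. x = real m *\<^sub>R c + d"
proof -
  define K where "K = (\<lambda>(m::nat, k::nat, F).
    \<Union>x\<in>(\<lambda>c. real m *\<^sub>R c) ` C. \<Union>y\<in>box_combinations (real k) F. {x + y})"
  define I :: "(nat \<times> nat \<times> 'a set) set" where "I = UNIV \<times> UNIV \<times> Fpow D"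
  have "countable I"
    unfolding I_def using D by (intro countable_SIGMA countable_Fpow) auto
  have closedK: "closed (K i)" if "i \<in> I" for i
  proof -
    obtain m k F where i: "i = (m, k, F)" by (cases i)
    then have "finite F" using that unfolding I_def Fpow_def by simp
    then show ?thesis
      unfolding i K_def prod.case
      by (intro closed_compact_sums closed_scaling compact_box_combinations C(1))
  qed
  have convexK: "convex (K i)" for i
    unfolding K_def case_prod_beta
    by (intro convex_sums convex_scaling convex_box_combinations C(2))
  have symK: "- x \<in> K i" if xK: "x \<in> K i" for x i
  proof -
    obtain m k F where i: "i = (m, k, F)" by (cases i)
    obtain c y where c: "c \<in> C" and y: "y \<in> box_combinations (real k) F"
      and x: "x = real m *\<^sub>R c + y"
      using xK unfolding i K_def prod.case by blast
    have "- x = real m *\<^sub>R (- c) + (- y)" using x by simp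
    then show ?thesis
      using C(3)[OF c] uminus_box_combinations[OF y] unfolding i K_def by blast
  qed
  have "\<Union>(K ` I) = UNIV"
  proof (intro equalityI subsetI UNIV_I)
    fix x
    obtain m c d where c: "c \<in> C" and d: "d \<in> span D" and x: "x = real m *\<^sub>R c + d"
      using exhaust by blast
    obtain F k where "finite F" "F \<subseteq> D" "d \<in> box_combinations (real k) F"
      using span_in_box_combinations[OF d] .
    then have "x \<in> K (m, k, F)" "(m, k, F) \<in> I"
      using c x unfolding K_def I_def Fpow_def by auto
    then show "x \<in> \<Union>(K ` I)" by blast
  qed
  have "\<exists>i\<in>I. interior (K i) \<noteq> {}"
  proof (rule ccontr)
    assume none: "\<not> (\<exists>i\<in>I. interior (K i) \<noteq> {})"
    have "euclidean interior_of (\<Union>(K ` I)) = {}"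
    proof (rule Baire_category_alt)
      show "countable (K ` I)" using \<open>countable I\<close> by (rule countable_image)
      show "closedin euclidean T \<and> euclidean interior_of T = {}" if T: "T \<in> K ` I" for T
      proof -
        obtain i where "i \<in> I" "T = K i" using T by blast
        then show ?thesis using closedK none by simp
      qed
    qed (simp add: completely_metrizable_space_euclidean)
    then show False using \<open>\<Union>(K ` I) = UNIV\<close> by simp
  qed
  then obtain i where i: "i \<in> I" "interior (K i) \<noteq> {}" by blast
  obtain m k F where mkF: "i = (m, k, F)" by (cases i)
  obtain r where r: "r > 0" "ball 0 r \<subseteq> K i"
    using convex_symmetric_interior_imp_ball[OF convexK symK i(2)] .
  have "\<exists>c\<in>C. \<exists>d\<in>span F. x = real m *\<^sub>R c + d" if "norm x < r" for x
  proof -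
    have "x \<in> K i" using that r(2) by auto
    then show ?thesis
      using box_combinations_subset_span unfolding K_def mkF by force
  qed
  moreover have "finite F" "F \<subseteq> D" using i(1) unfolding mkF I_def Fpow_def by auto
  ultimately show thesis using that r(1) by blast
qed

section \<open>Uniform boundedness on a subspace of countable codimension\<close>

lemma complementary_subset_of_spanning_set:
  fixes S :: "'a::real_vector set"
  assumes S: "subspace S" and spanning: "span (S \<union> D) = UNIV"
  obtains E where "E \<subseteq> D" "S \<inter> span E = {0}" "\<And>x. \<exists>s\<in>S. \<exists>e\<in>span E. x = s + e"
proof -
  obtain A where A: "A \<subseteq> S" "independent A" "S \<subseteq> span A"
    using maximal_independent_subset by blast
  have spanA: "span A = S" using A(1,3) S by (simp add: span_subspace)
  obtain B where B: "A \<subseteq> B" "B \<subseteq> A \<union> D" "independent B" "A \<union> D \<subseteq> span B"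
    using maximal_independent_subset_extend[of A "A \<union> D"] A(2) by blast
  define E where "E = B - A"
  have "E \<subseteq> D" using B(2) unfolding E_def by blast
  moreover have "S \<inter> span E = {0}"
  proof -
    \<comment> \<open>The linear map killing \<open>A\<close> and fixing \<open>E\<close> is both zero and the identity on the intersection.\<close>
    obtain g where g: "linear g" "\<forall>x\<in>B. g x = (if x \<in> A then 0 else x)"
      using linear_independent_extend[OF B(3), of "\<lambda>x. if x \<in> A then 0 else x"] by blast
    have "g x = 0" if "x \<in> span A" for x
      by (rule linear_eq_0_on_span[OF g(1) _ that]) (use g(2) B(1) in auto)
    moreover have "g x = x" if "x \<in> span E" for x
      by (rule linear_eq_on_span[OF g(1) linear_ident _ that]) (use g(2) E_def in auto)
    ultimately show ?thesis
      using spanA span_0 by fastforce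
  qed
  moreover have "\<exists>s\<in>S. \<exists>e\<in>span E. x = s + e" for x
  proof -
    have "S \<union> D \<subseteq> span B"
      using B(1,4) spanA span_mono by blast
    then have "span B = UNIV"
      using spanning by (metis span_mono span_span top.extremum_uniqueI)
    moreover have "B = A \<union> E" unfolding E_def using B(1) by blast
    ultimately have "x \<in> span (A \<union> E)" by simp
    then show ?thesis unfolding span_Un spanA by blast
  qed
  ultimately show thesis by (rule that)
qed

text \<open>
  For \<open>D = {}\<close> this is the classical uniform boundedness principle. In general the vectors of \<open>D\<close>
  may be taken independent modulo the space \<open>B\<close> of bounded orbits; the finite-dimensional part of
  the decomposition supplied by the Baire argument then vanishes on \<open>B\<close>.
\<close>

lemma uniform_bound_on_bounded_orbits:
  fixes T :: "'i \<Rightarrow> 'a::banach \<Rightarrow> 'b::real_normed_vector"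
  defines "B \<equiv> \<lambda>I. {x. \<exists>K. \<forall>i\<in>I. norm (T i x) \<le> K}"
  assumes T: "\<And>i. i \<in> I \<Longrightarrow> bounded_linear (T i)"
    and D: "countable D" "span (B I \<union> D) = UNIV"
  shows "\<exists>M. \<forall>i\<in>I. \<forall>x\<in>B I. norm (T i x) \<le> M * norm x"
proof -
  have lin: "T i (a *\<^sub>R x) = a *\<^sub>R T i x" "T i (x + y) = T i x + T i y" "T i 0 = 0" "T i (- x) = - T i x"
    if "i \<in> I" for i a x y
    using bounded_linear.linear[OF T[OF that]]
    by (auto simp: linear_cmul linear_add linear_0 linear_neg)
  have B: "subspace (B I)"
  proof (rule subspaceI)
    show "0 \<in> B I" unfolding B_def using lin(3) by auto
  next
    fix x y assume "x \<in> B I" "y \<in> B I"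
    then obtain K L where K: "\<forall>i\<in>I. norm (T i x) \<le> K" and L: "\<forall>i\<in>I. norm (T i y) \<le> L"
      unfolding B_def by blast
    have "\<forall>i\<in>I. norm (T i (x + y)) \<le> K + L"
      using K L by (simp add: lin(2) norm_add_rule_thm)
    then show "x + y \<in> B I" unfolding B_def by blast
  next
    fix a x assume "x \<in> B I"
    then obtain K where K: "\<forall>i\<in>I. norm (T i x) \<le> K" unfolding B_def by blast
    have "\<forall>i\<in>I. norm (T i (a *\<^sub>R x)) \<le> \<bar>a\<bar> * K"
      using K by (simp add: lin(1) mult_left_mono)
    then show "a *\<^sub>R x \<in> B I" unfolding B_def by blast
  qed
  obtain E where E: "E \<subseteq> D" "B I \<inter> span E = {0}" "\<And>x. \<exists>s\<in>B I. \<exists>e\<in>span E. x = s + e"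
    using complementary_subset_of_spanning_set[OF B D(2)] by metis
  define C where "C = (\<Inter>i\<in>I. T i -` cball 0 1)"
  have normC: "norm (T i c) \<le> 1" if "c \<in> C" "i \<in> I" for c i
    using that unfolding C_def by auto
  have "closed C"
    unfolding C_def
    by (intro closed_INT ballI closed_vimage closed_cball linear_continuous_on T)
  moreover have "convex C"
    unfolding C_def
    by (intro convex_INT convex_linear_vimage convex_cball bounded_linear.linear T)
  moreover have "- x \<in> C" if "x \<in> C" for x
    using that lin(4) unfolding C_def by simp
  moreover have "countable E" using D(1) E(1) countable_subset by blast
  moreover have "\<exists>m::nat. \<exists>c\<in>C. \<exists>d\<in>span E. x = real m *\<^sub>R c + d" for x
  proof -
    obtain b e where b: "b \<in> B I" and e: "e \<in> span E" and x: "x = b + e" using E(3) by blast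
    obtain K where K: "\<forall>i\<in>I. norm (T i b) \<le> K" using b unfolding B_def by blast
    obtain m :: nat where m: "max K 1 \<le> real m" using real_arch_simple by blast
    have "norm (T i ((1 / real m) *\<^sub>R b)) \<le> 1" if "i \<in> I" for i
    proof -
      have "norm (T i b) \<le> real m" using K m that by force
      then show ?thesis using m that by (simp add: lin(1))
    qed
    then have "(1 / real m) *\<^sub>R b \<in> C" unfolding C_def by simp
    moreover have "x = real m *\<^sub>R ((1 / real m) *\<^sub>R b) + e" using x m by simp
    ultimately show ?thesis using e by blast
  qed
  ultimately obtain r and m :: nat and F where r: "r > 0" and F: "F \<subseteq> E"
    and absorb: "\<And>x. norm x < r \<Longrightarrow> \<exists>c\<in>C. \<exists>d\<in>span F. x = real m *\<^sub>R c + d"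
    using countable_exhaustion_absorbs_ball[of C E] by metis
  have small: "norm (T i y) \<le> real m" if y: "y \<in> B I" "norm y < r" and i: "i \<in> I" for i y
  proof -
    obtain c d where c: "c \<in> C" and d: "d \<in> span F" and yd: "y = real m *\<^sub>R c + d"
      using absorb[OF y(2)] by blast
    have "c \<in> B I" using normC[OF c] unfolding B_def by blast
    then have "y - real m *\<^sub>R c \<in> B I"
      using y(1) B by (intro subspace_diff subspace_scale)
    moreover have "y - real m *\<^sub>R c = d" using yd by simp
    moreover have "d \<in> span E" using d span_mono[OF F] by blast
    ultimately have "d \<in> B I \<inter> span E" by simp
    then have "d = 0" using E(2) by blast
    then have "y = real m *\<^sub>R c" using yd by simp
    then show ?thesis
      using normC[OF c i] by (simp add: lin(1)[OF i] mult_left_le)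
  qed
  have "norm (T i x) \<le> (2 * real m / r) * norm x" if i: "i \<in> I" and x: "x \<in> B I" for i x
  proof (cases "x = 0")
    case True
    then show ?thesis using lin(3)[OF i] by simp
  next
    case False
    define a where "a = r / (2 * norm x)"
    have a: "a > 0" "a * norm x < r" using False r unfolding a_def by auto
    have "norm (T i (a *\<^sub>R x)) \<le> real m"
      using a x B i by (intro small) (auto simp: subspace_scale)
    then have "a * norm (T i x) \<le> real m"
      using a(1) by (simp add: lin(1)[OF i])
    then have "norm (T i x) \<le> real m / a" using a(1) by (simp add: field_simps)
    also have "\<dots> = (2 * real m / r) * norm x" unfolding a_def by simp
    finally show ?thesis .
  qed
  then show ?thesis by blast
qed

section \<open>Bases of a quotient space\<close>

lemma mem_coset_iff: "x \<in> coset S y \<longleftrightarrow> x - y \<in> S"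
  unfolding coset_def by (auto simp: image_iff algebra_simps intro: bexI[of _ "x - y"])

lemma coset_representative:
  assumes S: "subspace S" and A: "A \<in> quotient_space S"
  shows "A = coset S (SOME x. x \<in> A)"
proof -
  obtain a where a: "A = coset S a" using A unfolding quotient_space_def by blast
  then have "a \<in> A" using S by (simp add: mem_coset_iff subspace_0)
  then have "(SOME x. x \<in> A) \<in> A" by (rule someI)
  then have "(SOME x. x \<in> A) - a \<in> S" using a by (simp add: mem_coset_iff)
  then show ?thesis using a coset_eq_iff[OF S] by metis
qed

lemma quotient_basis_representatives_span:
  assumes S: "subspace S" and \<B>: "quotient_basis S \<B>"
  shows "span (S \<union> (\<lambda>A. SOME x. x \<in> A) ` \<B>) = UNIV"
proof (intro equalityI subset_UNIV subsetI)
  fix x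
  have "coset S x \<in> quotient_space S" unfolding quotient_space_def by blast
  moreover have "\<forall>Q\<in>quotient_space S. \<exists>F c. finite F \<and> F \<subseteq> \<B> \<and> Q = quotient_lincomb S F c"
    using \<B>[unfolded quotient_basis_def, THEN conjunct2, THEN conjunct2] .
  ultimately obtain F c where F: "finite F" "F \<subseteq> \<B>" "coset S x = quotient_lincomb S F c"
    by meson
  then have "x - (\<Sum>A\<in>F. c A *\<^sub>R (SOME x. x \<in> A)) \<in> S"
    unfolding quotient_lincomb_def coset_eq_iff[OF S] by simp
  then have "x - (\<Sum>A\<in>F. c A *\<^sub>R (SOME x. x \<in> A)) \<in> span (S \<union> (\<lambda>A. SOME x. x \<in> A) ` \<B>)"
    by (intro span_base) simp
  moreover have "(\<Sum>A\<in>F. c A *\<^sub>R (SOME x. x \<in> A)) \<in> span (S \<union> (\<lambda>A. SOME x. x \<in> A) ` \<B>)"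
    using F(2) by (intro span_sum span_scale span_base) auto
  ultimately show "x \<in> span (S \<union> (\<lambda>A. SOME x. x \<in> A) ` \<B>)"
    using span_add by fastforce
qed

text \<open>
  A basis element whose representative lies outside the finite set would be a linear combination
  of those whose representatives lie inside it.
\<close>

lemma finite_quotient_basis:
  assumes S: "subspace S" and \<B>: "quotient_basis S \<B>"
    and F: "finite F" "F \<subseteq> (\<lambda>A. SOME x. x \<in> A) ` \<B>" and spanning: "span (S \<union> F) = UNIV"
  shows "finite \<B>"
proof -
  define rep :: "'a set \<Rightarrow> 'a" where "rep = (\<lambda>A. SOME x. x \<in> A)"
  have "inj_on rep \<B>"
  proof (rule inj_onI)
    fix A A' assume A: "A \<in> \<B>" "A' \<in> \<B>" "rep A = rep A'"
    have "A = coset S (rep A)" "A' = coset S (rep A')"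
      using A(1,2) \<B> unfolding quotient_basis_def rep_def
      by (auto intro!: coset_representative[OF S])
    then show "A = A'" using A(3) by simp
  qed
  define \<F> where "\<F> = {A \<in> \<B>. rep A \<in> F}"
  have injF: "inj_on rep \<F>" using \<open>inj_on rep \<B>\<close> unfolding \<F>_def by (rule inj_on_subset) auto
  have imF: "rep ` \<F> = F" using F(2) unfolding \<F>_def rep_def by auto
  have "finite \<F>" using F(1) finite_image_iff[OF injF] imF by simp
  have "A \<in> \<F>" if "A \<in> \<B>" for A
  proof (rule ccontr)
    assume "A \<notin> \<F>"
    have "rep A \<in> span (S \<union> F)" using spanning by simp
    then obtain s f where s: "s \<in> S" and f: "f \<in> span F" and rep: "rep A = s + f"
      unfolding span_Un span_eq_iff[THEN iffD2, OF S] by blast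
    obtain a where a: "f = (\<Sum>v\<in>F. a v *\<^sub>R v)"
      using f unfolding span_finite[OF F(1)] by blast
    have a': "f = (\<Sum>A'\<in>\<F>. a (rep A') *\<^sub>R rep A')"
      unfolding a imF[symmetric] by (simp add: sum.reindex[OF injF])
    define c where "c = (\<lambda>A'. if A' = A then 1 else - a (rep A'))"
    have "(\<Sum>A'\<in>\<F>. c A' *\<^sub>R rep A') = (\<Sum>A'\<in>\<F>. - (a (rep A') *\<^sub>R rep A'))"
      using \<open>A \<notin> \<F>\<close> unfolding c_def by (intro sum.cong) auto
    then have "(\<Sum>A'\<in>insert A \<F>. c A' *\<^sub>R rep A') = rep A - f"
      using \<open>finite \<F>\<close> \<open>A \<notin> \<F>\<close> a' by (simp add: c_def sum_negf)
    then have "quotient_lincomb S (insert A \<F>) c = coset S s"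
      unfolding quotient_lincomb_def using rep by (simp add: rep_def)
    also have "\<dots> = coset S 0" using s by (simp add: coset_eq_iff[OF S])
    also have "\<dots> = S" by (simp add: coset_def)
    finally have "quotient_lincomb S (insert A \<F>) c = S" .
    moreover have "finite (insert A \<F>)" "insert A \<F> \<subseteq> \<B>"
      using \<open>finite \<F>\<close> that unfolding \<F>_def by auto
    ultimately have "c A = 0" using \<B> unfolding quotient_basis_def by blast
    then show False unfolding c_def by simp
  qed
  then have "\<B> \<subseteq> \<F>" by (rule subsetI)
  then show ?thesis using \<open>finite \<F>\<close> by (rule finite_subset)
qed

text \<open>
  A closed subspace is a closed convex symmetric set containing all its multiples, so the
  absorbed ball lies in the sum of \<open>S\<close> and a finite-dimensional span. That sum is a subspace,
  hence everything.
\<close>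

lemma closed_countable_codim_imp_finite_codim:
  fixes S :: "'a::banach set"
  assumes S: "subspace S" "closed S" and "countable_codim S"
  shows "finite_codim S"
proof -
  obtain \<B> where \<B>: "quotient_basis S \<B>" "countable \<B>"
    using assms(3) unfolding countable_codim_def by blast
  let ?D = "(\<lambda>A. SOME x. x \<in> A) ` \<B>"
  have "\<exists>m::nat. \<exists>c\<in>S. \<exists>d\<in>span ?D. x = real m *\<^sub>R c + d" for x
  proof -
    have "x \<in> span (S \<union> ?D)" using quotient_basis_representatives_span[OF S(1) \<B>(1)] by simp
    then obtain s d where "s \<in> S" "d \<in> span ?D" "x = s + d"
      unfolding span_Un span_eq_iff[THEN iffD2, OF S(1)] by blast
    then show ?thesis by (intro exI[of _ 1]) auto
  qed
  then obtain r and m :: nat and F where r: "r > 0" and F: "finite F" "F \<subseteq> ?D"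
    and absorb: "\<And>x. norm x < r \<Longrightarrow> \<exists>c\<in>S. \<exists>d\<in>span F. x = real m *\<^sub>R c + d"
    using countable_exhaustion_absorbs_ball[OF S(2) subspace_imp_convex[OF S(1)] subspace_neg[OF S(1)],
        of ?D] \<B>(2) by (metis (no_types, lifting) countable_image)
  have small: "x \<in> span (S \<union> F)" if x: "norm x < r" for x
  proof -
    obtain c d where "c \<in> S" "d \<in> span F" "x = real m *\<^sub>R c + d" using absorb[OF x] by blast
    then show ?thesis
      unfolding span_Un by (blast intro: span_scale span_base)
  qed
  have "x \<in> span (S \<union> F)" for x
  proof (cases "x = 0")
    case False
    have "(r / (2 * norm x)) *\<^sub>R x \<in> span (S \<union> F)"
      using False r by (intro small) simp
    then have "(2 * norm x / r) *\<^sub>R (r / (2 * norm x)) *\<^sub>R x \<in> span (S \<union> F)"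
      by (rule span_scale)
    then show ?thesis using False r by simp
  qed (simp add: span_0)
  then have "span (S \<union> F) = UNIV" by blast
  then have "finite \<B>" using finite_quotient_basis[OF S(1) \<B>(1) F] by blast
  then show ?thesis using \<B>(1) unfolding finite_codim_def by blast
qed

section \<open>The stable subspace of a semigroup\<close>

lemma subspace_stable_subspace:
  assumes "operator_semigroup \<phi>"
  shows "subspace (stable_subspace \<phi>)"
proof -
  have bl: "bounded_linear (\<phi> t)" if "t \<ge> 0" for t
    using assms that unfolding operator_semigroup_def by blast
  have nonneg: "eventually (\<lambda>t::real. t \<ge> 0) at_top" by (rule eventually_ge_at_top)
  show ?thesis
  proof (rule subspaceI)
    have "eventually (\<lambda>t. 0 = \<phi> t 0) at_top"
      using nonneg by eventually_elim (simp add: bl linear_simps)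
    then show "0 \<in> stable_subspace \<phi>"
      unfolding stable_subspace_def using tendsto_cong[THEN iffD1, OF _ tendsto_const] by fast
  next
    fix x y assume "x \<in> stable_subspace \<phi>" "y \<in> stable_subspace \<phi>"
    then have "((\<lambda>t. \<phi> t x + \<phi> t y) \<longlongrightarrow> 0) at_top"
      unfolding stable_subspace_def using tendsto_add[of _ 0 _ _ 0] by fastforce
    moreover have "eventually (\<lambda>t. \<phi> t x + \<phi> t y = \<phi> t (x + y)) at_top"
      using nonneg by eventually_elim (simp add: bl linear_simps)
    ultimately show "x + y \<in> stable_subspace \<phi>"
      unfolding stable_subspace_def using tendsto_cong by fast
  next
    fix c x assume "x \<in> stable_subspace \<phi>"
    then have "((\<lambda>t. c *\<^sub>R \<phi> t x) \<longlongrightarrow> 0) at_top"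
      unfolding stable_subspace_def using tendsto_scaleR[OF tendsto_const[of c], of _ 0] by fastforce
    moreover have "eventually (\<lambda>t. c *\<^sub>R \<phi> t x = \<phi> t (c *\<^sub>R x)) at_top"
      using nonneg by eventually_elim (simp add: bl linear_simps)
    ultimately show "c *\<^sub>R x \<in> stable_subspace \<phi>"
      unfolding stable_subspace_def using tendsto_cong by fast
  qed
qed

lemma stable_subspace_invariant:
  assumes sg: "operator_semigroup \<phi>" and x: "x \<in> stable_subspace \<phi>" and t: "t \<ge> 0"
  shows "\<phi> t x \<in> stable_subspace \<phi>"
proof -
  have "filterlim (\<lambda>s::real. t + s) at_top at_top"
    by (intro filterlim_tendsto_add_at_top[OF tendsto_const] filterlim_ident)
  then have "((\<lambda>s. \<phi> (t + s) x) \<longlongrightarrow> 0) at_top"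
    using x unfolding stable_subspace_def by (auto intro: filterlim_compose)
  moreover have "eventually (\<lambda>s. \<phi> (t + s) x = \<phi> s (\<phi> t x)) at_top"
    using eventually_ge_at_top[of 0]
  proof eventually_elim
    case (elim s)
    then have "\<phi> s \<circ> \<phi> t = \<phi> (s + t)"
      using sg t unfolding operator_semigroup_def by blast
    then show ?case by (metis add.commute comp_apply)
  qed
  ultimately show ?thesis unfolding stable_subspace_def using tendsto_cong by fast
qed

text \<open>Convergence controls the tail of an orbit, compactness of \<open>{a..N}\<close> the rest.\<close>

lemma stable_orbit_bounded:
  assumes "continuous_on {a..} (\<lambda>t. \<phi> t x)" and x: "x \<in> stable_subspace \<phi>"
  shows "\<exists>K. \<forall>t\<in>{a..}. norm (\<phi> t x) \<le> K"
proof -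
  have "((\<lambda>t. norm (\<phi> t x)) \<longlongrightarrow> 0) at_top"
    using x unfolding stable_subspace_def by (auto intro: tendsto_norm_zero)
  then have "eventually (\<lambda>t. norm (\<phi> t x) < 1) at_top"
    by (rule order_tendstoD) simp
  then obtain N where N: "\<And>t. t \<ge> N \<Longrightarrow> norm (\<phi> t x) < 1"
    unfolding eventually_at_top_linorder by blast
  have "compact ((\<lambda>t. \<phi> t x) ` {a..N})"
    using continuous_on_subset[OF assms(1)] by (intro compact_continuous_image) auto
  then have "bounded ((\<lambda>t. \<phi> t x) ` {a..N})" by (rule compact_imp_bounded)
  then obtain K where K: "\<And>t. t \<in> {a..N} \<Longrightarrow> norm (\<phi> t x) \<le> K"
    unfolding bounded_iff by blast
  have "norm (\<phi> t x) \<le> max K 1" if "t \<ge> a" for t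
    using K[of t] N[of t] that by (cases "t \<le> N") auto
  then show ?thesis by auto
qed

text \<open>
  The starting time \<open>a\<close> is kept general because closedness uses \<open>a = 1\<close>, away from the possible
  singularity at \<open>0\<close>, and boundedness of the semigroup uses \<open>a = 0\<close>.
\<close>

lemma uniform_bound_on_stable_subspace:
  fixes \<phi> :: "real \<Rightarrow> 'a::banach \<Rightarrow> 'a"
  assumes sg: "operator_semigroup \<phi>" and a: "a \<ge> 0"
    and cont: "\<And>v. continuous_on {a..} (\<lambda>t. \<phi> t v)"
    and codim: "countable_codim (stable_subspace \<phi>)"
  obtains M where "\<And>t x. t \<ge> a \<Longrightarrow> x \<in> stable_subspace \<phi> \<Longrightarrow> norm (\<phi> t x) \<le> M * norm x"
proof -
  let ?B = "{x. \<exists>K. \<forall>t\<in>{a..}. norm (\<phi> t x) \<le> K}"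
  obtain \<B> where \<B>: "quotient_basis (stable_subspace \<phi>) \<B>" "countable \<B>"
    using codim unfolding countable_codim_def by blast
  let ?D = "(\<lambda>A. SOME x. x \<in> A) ` \<B>"
  have sub: "stable_subspace \<phi> \<subseteq> ?B"
    using stable_orbit_bounded[where \<phi> = \<phi>, OF cont] by blast
  have "span (stable_subspace \<phi> \<union> ?D) \<subseteq> span (?B \<union> ?D)"
    using sub by (intro span_mono) blast
  then have "span (?B \<union> ?D) = UNIV"
    using quotient_basis_representatives_span[OF subspace_stable_subspace[OF sg] \<B>(1)] by auto
  moreover have "bounded_linear (\<phi> t)" if "t \<in> {a..}" for t
    using sg a that unfolding operator_semigroup_def by auto
  ultimately obtain M where "\<forall>t\<in>{a..}. \<forall>x\<in>?B. norm (\<phi> t x) \<le> M * norm x"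
    using uniform_bound_on_bounded_orbits[of "{a..}" \<phi> ?D] \<B>(2) by auto
  then show thesis using that sub by (meson atLeast_iff subsetD)
qed

lemma closed_stable_subspace:
  fixes \<phi> :: "real \<Rightarrow> 'a::real_normed_vector \<Rightarrow> 'a"
  assumes sg: "operator_semigroup \<phi>"
    and M: "\<And>t x. t \<ge> a \<Longrightarrow> x \<in> stable_subspace \<phi> \<Longrightarrow> norm (\<phi> t x) \<le> M * norm x"
  shows "closed (stable_subspace \<phi>)"
proof -
  have "x \<in> stable_subspace \<phi>" if x: "x \<in> closure (stable_subspace \<phi>)" for x
  proof -
    \<comment> \<open>The uniform bound passes to the closure because it is a closed condition for each \<open>t\<close>.\<close>
    have diff: "norm (\<phi> t (x - y)) \<le> M * norm (x - y)"
      if t: "t \<ge> max a 0" and y: "y \<in> stable_subspace \<phi>" for t y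
    proof -
      have bl: "bounded_linear (\<phi> t)" using sg t unfolding operator_semigroup_def by simp
      have "closed {z. norm (\<phi> t (z - y)) \<le> M * norm (z - y)}"
        by (intro closed_Collect_le continuous_intros bounded_linear.continuous_on[OF bl])
      moreover have "stable_subspace \<phi> \<subseteq> {z. norm (\<phi> t (z - y)) \<le> M * norm (z - y)}"
        using M t subspace_diff[OF subspace_stable_subspace[OF sg] _ y] by auto
      ultimately have "closure (stable_subspace \<phi>) \<subseteq> {z. norm (\<phi> t (z - y)) \<le> M * norm (z - y)}"
        by (rule closure_minimal[rotated])
      then show ?thesis using x by blast
    qed
    have "((\<lambda>t. \<phi> t x) \<longlongrightarrow> 0) at_top"
    proof (rule tendstoI)
      fix e :: real assume e: "e > 0"
      define d where "d = e / (2 * (\<bar>M\<bar> + 1))"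
      have d: "d > 0" "\<bar>M\<bar> * d < e / 2" using e unfolding d_def by (auto simp: field_simps)
      obtain y where y: "y \<in> stable_subspace \<phi>" "dist y x < d"
        using x d(1) unfolding closure_approachable by blast
      have "eventually (\<lambda>t. norm (\<phi> t y) < e / 2) at_top"
        using y(1) e unfolding stable_subspace_def
        by (auto dest: tendstoD[of _ _ _ "e / 2"])
      with eventually_ge_at_top[of "max a 0"]
      show "eventually (\<lambda>t. dist (\<phi> t x) 0 < e) at_top"
      proof eventually_elim
        case (elim t)
        have "bounded_linear (\<phi> t)" using sg elim unfolding operator_semigroup_def by simp
        then have "\<phi> t x = \<phi> t (x - y) + \<phi> t y" by (simp add: linear_simps)
        then have "norm (\<phi> t x) \<le> norm (\<phi> t (x - y)) + norm (\<phi> t y)"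
          by (simp add: norm_triangle_ineq)
        moreover have "norm (\<phi> t (x - y)) \<le> M * norm (x - y)"
          using diff[OF elim(1) y(1)] .
        moreover have "M * norm (x - y) \<le> \<bar>M\<bar> * d"
          using y(2) by (intro mult_mono) (auto simp: dist_norm norm_minus_commute)
        ultimately show ?case using d(2) elim by simp
      qed
    qed
    then show ?thesis unfolding stable_subspace_def by simp
  qed
  then show ?thesis using closure_subset_eq by blast
qed

theorem theorem1:
  fixes \<phi> :: "real \<Rightarrow> 'a::banach \<Rightarrow> 'a"
  assumes "operator_semigroup \<phi>"
    and "\<And>v. continuous_on {0<..} (\<lambda>t. \<phi> t v)"
    and "countable_codim (stable_subspace \<phi>)"
  shows "subspace (stable_subspace \<phi>) \<and> closed (stable_subspace \<phi>)
    \<and> finite_codim (stable_subspace \<phi>)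
    \<and> ((\<forall>v. continuous (at 0 within {0..}) (\<lambda>t. \<phi> t v))
        \<longrightarrow> bounded_semigroup_on (stable_subspace \<phi>) \<phi>)"
proof (intro conjI impI)
  show sub: "subspace (stable_subspace \<phi>)"
    by (rule subspace_stable_subspace[OF assms(1)])
  have "continuous_on {1..} (\<lambda>t. \<phi> t v)" for v
    by (rule continuous_on_subset[OF assms(2)]) auto
  then obtain M where "\<And>t x. t \<ge> 1 \<Longrightarrow> x \<in> stable_subspace \<phi> \<Longrightarrow> norm (\<phi> t x) \<le> M * norm x"
    using uniform_bound_on_stable_subspace[OF assms(1) _ _ assms(3), of 1] by auto
  then show cl: "closed (stable_subspace \<phi>)"
    by (rule closed_stable_subspace[OF assms(1)])
  show "finite_codim (stable_subspace \<phi>)"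
    by (rule closed_countable_codim_imp_finite_codim[OF sub cl assms(3)])
next
  assume c0: "\<forall>v. continuous (at 0 within {0..}) (\<lambda>t. \<phi> t v)"
  have "continuous_on {0..} (\<lambda>t. \<phi> t v)" for v
    unfolding continuous_on_eq_continuous_within
  proof
    fix t :: real assume "t \<in> {0..}"
    then consider "t = 0" | "t \<in> {0<..}" by fastforce
    then show "continuous (at t within {0..}) (\<lambda>t. \<phi> t v)"
    proof cases
      case 1
      then show ?thesis using c0 by simp
    next
      case 2
      then have "isCont (\<lambda>t. \<phi> t v) t"
        using assms(2)[of v] continuous_on_eq_continuous_at[OF open_greaterThan] by blast
      then show ?thesis by (rule continuous_at_imp_continuous_at_within)
    qed
  qed
  then obtain M where M: "\<And>t x. t \<ge> 0 \<Longrightarrow> x \<in> stable_subspace \<phi> \<Longrightarrow> norm (\<phi> t x) \<le> M * norm x"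
    using uniform_bound_on_stable_subspace[OF assms(1) _ _ assms(3), of 0] by auto
  \<comment> \<open>The absolute value covers \<open>x = 0\<close>, where the quotient of norms is \<open>0\<close>.\<close>
  have "norm (\<phi> t x) / norm x \<le> \<bar>M\<bar>" if "t \<ge> 0" "x \<in> stable_subspace \<phi>" for t x
  proof (cases "x = 0")
    case False
    then have "norm (\<phi> t x) / norm x \<le> M" using M[OF that] by (simp add: divide_le_eq)
    then show ?thesis by simp
  qed simp
  then have "\<forall>t\<ge>0. onorm_on (stable_subspace \<phi>) (\<phi> t) \<le> ereal \<bar>M\<bar>"
    unfolding onorm_on_def by (auto intro!: SUP_least)
  moreover have "\<phi> t (\<phi> q x) = \<phi> (t + q) x" if "t \<ge> 0" "q \<ge> 0" for t q x
    using assms(1) that unfolding operator_semigroup_def by (metis comp_apply)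
  ultimately show "bounded_semigroup_on (stable_subspace \<phi>) \<phi>"
    unfolding bounded_semigroup_on_def
    using stable_subspace_invariant[OF assms(1)] by blast
qed

end
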